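(* Let $\Sigma$ be a finite alphabet and let $S=\{s_1,s_2\}$ be a set of two strings in $\Sigma^n$. Then Algorithm A (described in the context), run on $S$, always outputs an exact solution of the closest string problem for $S$, i.e. a string $t\in\Sigma^n$ with $\max(d(t,s_1),d(t,s_2))=\min_{u\in\Sigma^n}\max(d(u,s_1),d(u,s_2))$.
   Context: For equal-length strings $s,t$, $d(s,t)$ is the Hamming distance (number of positions $i$ with $s[i]\neq t[i]$). The closest string problem (CSP): given $S=\{s_1,\dots,s_m\}\subseteq\Sigma^n$, find $t\in\Sigma^n$ minimizing $d$ subject to $d(t,s_i)\le d$ for all $i$. It is formulated as the integer program: minimize $d$ subject to $\sum_{a\in\Sigma}x_{a,j}=1$ for $j=1,\dots,n$, and $n-\sum_{j=1}^n x_{s_i[j],j}\le d$ for $i=1,\dots,m$, with $x_{a,j}\in\{0,1\}$ and $d$ a nonnegative integer ($x_{a,j}=1$ means $t[j]=a$). Its LP relaxation replaces $x_{a,j}\in\{0,1\}$ by $0\le x_{a,j}\le 1$ and lets $d$ be real. Algorithm A: start with $V_1=V_0=\emptyset$. For $i=1,\dots,n$: fix all variables in $V_1$ to $1$ and all variables in $V_0$ to $0$; solve the LP relaxation in the remaining (unfixed) variables; pick a variable $x_{b,k}$ not in $V_1$ having the largest value in this LP optimal solution; add $x_{b,k}$ to $V_1$ and add all $x_{a,k}$ with $a\neq b$ to $V_0$. Finally output the string $t$ with $t[k]=a$ for every $x_{a,k}\in V_1$. *)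

theory Defs
  imports Complex_Main
begin

definition strings :: "'a set \<Rightarrow> nat \<Rightarrow> 'a list set" where
  "strings \<Sigma> n = {t. length t = n \<and> set t \<subseteq> \<Sigma>}"

text \<open>Only used for lists of equal length.\<close>

definition hamming :: "'a list \<Rightarrow> 'a list \<Rightarrow> nat" where
  "hamming s t = card {j. j < length s \<and> s ! j \<noteq> t ! j}"

text \<open>
  The pair \<open>(a, j)\<close> stands for the LP variable that \<open>x a j\<close> gives the value of, where
  \<open>a \<in> \<Sigma>\<close> and \<open>j < n\<close>; positions are counted from 0. Values of \<open>x\<close> at other arguments
  are irrelevant. A state of the algorithm is the pair \<open>(V1, V0)\<close> of the sets of variables
  that are fixed to 1 and to 0.
\<close>

type_synonym 'a state = "('a \<times> nat) set \<times> ('a \<times> nat) set"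

definition lp_feasible ::
  "'a set \<Rightarrow> nat \<Rightarrow> 'a list set \<Rightarrow> 'a state \<Rightarrow> ('a \<Rightarrow> nat \<Rightarrow> real) \<Rightarrow> real \<Rightarrow> bool" where
  "lp_feasible \<Sigma> n S = (\<lambda>(V1, V0) x d.
     (\<forall>j<n. (\<Sum>a\<in>\<Sigma>. x a j) = 1) \<and>
     (\<forall>s\<in>S. real n - (\<Sum>j<n. x (s ! j) j) \<le> d) \<and>
     (\<forall>a\<in>\<Sigma>. \<forall>j<n. 0 \<le> x a j \<and> x a j \<le> 1) \<and>
     0 \<le> d \<and>
     (\<forall>(a, j)\<in>V1. x a j = 1) \<and>
     (\<forall>(a, j)\<in>V0. x a j = 0))"

definition lp_optimal ::
  "'a set \<Rightarrow> nat \<Rightarrow> 'a list set \<Rightarrow> 'a state \<Rightarrow> ('a \<Rightarrow> nat \<Rightarrow> real) \<Rightarrow> real \<Rightarrow> bool" where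
  "lp_optimal \<Sigma> n S V x d \<longleftrightarrow>
     lp_feasible \<Sigma> n S V x d \<and> (\<forall>x' d'. lp_feasible \<Sigma> n S V x' d' \<longrightarrow> d \<le> d')"

text \<open>
  One round of the algorithm, as a relation: both the optimal LP solution and the variable
  of largest value may be chosen arbitrarily.
\<close>

definition stepA :: "'a set \<Rightarrow> nat \<Rightarrow> 'a list set \<Rightarrow> 'a state \<Rightarrow> 'a state \<Rightarrow> bool" where
  "stepA \<Sigma> n S = (\<lambda>(V1, V0) (V1', V0').
     \<exists>x d. lp_optimal \<Sigma> n S (V1, V0) x d \<and>
       (\<exists>b\<in>\<Sigma>. \<exists>k<n. (b, k) \<notin> V1 \<and>
          (\<forall>a\<in>\<Sigma>. \<forall>j<n. (a, j) \<notin> V1 \<longrightarrow> x a j \<le> x b k) \<and>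
          V1' = insert (b, k) V1 \<and>
          V0' = V0 \<union> {(a, k) |a. a \<in> \<Sigma> \<and> a \<noteq> b}))"

text \<open>
  That the string read off from \<open>V1\<close> exists, is unique and is a string over \<open>\<Sigma>\<close> is not
  built in here.
\<close>

definition reads_off :: "nat \<Rightarrow> 'a state \<Rightarrow> 'a list \<Rightarrow> bool" where
  "reads_off n = (\<lambda>(V1, V0) t. length t = n \<and> (\<forall>(a, k)\<in>V1. t ! k = a))"

definition outputsA :: "'a set \<Rightarrow> nat \<Rightarrow> 'a list set \<Rightarrow> 'a list \<Rightarrow> bool" where
  "outputsA \<Sigma> n S t \<longleftrightarrow> (\<exists>V. (stepA \<Sigma> n S ^^ n) ({}, {}) V \<and> reads_off n V t)"

end

theory Submission
  imports Defs
begin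

text \<open>
  Let \<open>A\<close> and \<open>B\<close> be the distances to \<open>s1\<close> and \<open>s2\<close> already incurred on the fixed positions,
  and \<open>r\<close> the number of unfixed positions where \<open>s1\<close> and \<open>s2\<close> differ. As long as
  \<open>\<bar>A - B\<bar> \<le> max 1 r\<close>, the LP optimum is \<open>max ((A + B + r) / 2) (max A B)\<close>, and comparing the sum of the
  two distance constraints with this value shows that an optimal solution has value 1 at the common letter
  wherever the strings agree and distributes the weight 1 over the two letters wherever they
  differ. Hence a variable of largest value always names a letter of \<open>s1\<close> or \<open>s2\<close>. It also
  preserves the inequality: the string that is behind receives more than half of the weight in the tight
  cases, so a largest variable cannot favour the other one. At the end \<open>A + B\<close> is the distance
  between \<open>s1\<close> and \<open>s2\<close> and \<open>\<bar>A - B\<bar> \<le> 1\<close>, which is optimal by the triangle inequality.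
\<close>

section \<open>Partial strings and the states that encode them\<close>

definition misses :: "nat set \<Rightarrow> (nat \<Rightarrow> 'a) \<Rightarrow> 'a list \<Rightarrow> nat" where
  "misses F t s = card {j\<in>F. t j \<noteq> s ! j}"

lemma misses_insert:
  assumes "finite F" "k \<notin> F"
  shows "misses (insert k F) (t(k := b)) s = misses F t s + of_bool (b \<noteq> s ! k)"
proof -
  have "{j \<in> insert k F. (t(k := b)) j \<noteq> s ! j}
      = (if b \<noteq> s ! k then insert k {j\<in>F. t j \<noteq> s ! j} else {j\<in>F. t j \<noteq> s ! j})"
    using assms by auto
  then show ?thesis
    using assms by (simp add: misses_def)
qed

text \<open>These are the states in which exactly the positions of \<open>F\<close> are fixed, with
  letters given by \<open>t\<close>. Since \<open>t\<close> is a total function, fixing one more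
  position is a function update, and values of \<open>t\<close> outside \<open>F\<close> do not
  matter.\<close>

definition partial_state :: "'a set \<Rightarrow> nat set \<Rightarrow> (nat \<Rightarrow> 'a) \<Rightarrow> 'a state" where
  "partial_state \<Sigma> F t = ({(a, j). j \<in> F \<and> a = t j}, {(a, j). j \<in> F \<and> a \<in> \<Sigma> \<and> a \<noteq> t j})"

lemma partial_state_empty: "partial_state \<Sigma> {} t = ({}, {})"
  by (simp add: partial_state_def)

lemma partial_state_insert:
  assumes "k \<notin> F"
  shows "partial_state \<Sigma> (insert k F) (t(k := b)) =
    (insert (b, k) (fst (partial_state \<Sigma> F t)),
     snd (partial_state \<Sigma> F t) \<union> {(a, k) |a. a \<in> \<Sigma> \<and> a \<noteq> b})"
  using assms by (auto simp: partial_state_def)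

lemma reads_off_partial_state:
  "reads_off n (partial_state \<Sigma> {..<n} t) u \<longleftrightarrow> u = map t [0..<n]"
  by (auto simp: reads_off_def partial_state_def intro: nth_equalityI)

text \<open>Here \<open>q\<close> is the weight of the string whose letter is picked at
  \<open>k\<close>, \<open>p\<close> that of the other string, and \<open>A\<close> is the distance
  to the other string, which the pick raises by one. If the claim failed, \<open>total\<close> would
  bound the sum of \<open>q\<close> both by 1/2 and by \<open>(card R - 1) / 2\<close>. The first
  bound gives \<open>q k\<close> at most 1/2, so by maximality every \<open>p j\<close> is at most
  1/2 and every \<open>q j\<close> at least 1/2, which contradicts the second.\<close>

lemma largest_choice_balanced:
  fixes p q :: "nat \<Rightarrow> real" and A B :: nat
  assumes "finite R" "k \<in> R"
    and pq: "\<And>j. j \<in> R \<Longrightarrow> p j + q j = 1"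
    and q0: "\<And>j. j \<in> R \<Longrightarrow> 0 \<le> q j"
    and largest: "\<And>j. j \<in> R \<Longrightarrow> p j \<le> q k"
    and total: "A + (\<Sum>j\<in>R. q j) \<le> (A + B + real (card R)) / 2"
  shows "Suc A \<le> B + max 1 (card R - 1)"
proof (rule ccontr)
  assume neg: "\<not> ?thesis"
  have "card R > 0"
    using assms(1,2) card_gt_0_iff by blast
  with neg have ge: "real A \<ge> B + 1" "real A \<ge> B + real (card R) - 1"
    by (auto simp: max_def split: if_splits)
  have "q k \<le> (\<Sum>j\<in>R. q j)"
    using assms(1,2) q0 by (intro member_le_sum) auto
  with total ge have "q k \<le> 1 / 2"
    by (simp add: field_simps)
  then have "1 / 2 \<le> q j" if "j \<in> R" for j
    using pq[OF that] largest[OF that] by linarith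
  then have "(\<Sum>j\<in>R. 1 / 2) \<le> (\<Sum>j\<in>R. q j)"
    by (intro sum_mono)
  then have "real (card R) / 2 \<le> (\<Sum>j\<in>R. q j)"
    by simp
  with total ge show False
    by (simp add: field_simps)
qed

section \<open>The balance invariant and the value of the LP\<close>

locale two_strings =
  fixes \<Sigma> :: "'a set" and n :: nat and s1 s2 :: "'a list"
  assumes finite_alphabet: "finite \<Sigma>"
    and s1: "s1 \<in> strings \<Sigma> n" and s2: "s2 \<in> strings \<Sigma> n"
begin

lemma nth_in_alphabet: "j < n \<Longrightarrow> s1 ! j \<in> \<Sigma>" "j < n \<Longrightarrow> s2 ! j \<in> \<Sigma>"
  using s1 s2 by (auto simp: strings_def)

definition diffs :: "nat set" where
  "diffs = {j. j < n \<and> s1 ! j \<noteq> s2 ! j}"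

lemma finite_diffs: "finite diffs"
  by (simp add: diffs_def)

text \<open>The gap between the two distances can still be closed on the open differing positions.
  The \<open>max 1\<close> allows the gap of one that parity may force when no such position is
  left.\<close>

definition balanced :: "nat set \<Rightarrow> (nat \<Rightarrow> 'a) \<Rightarrow> bool" where
  "balanced F t \<longleftrightarrow> F \<subseteq> {..<n} \<and> (\<forall>j\<in>F. t j = s1 ! j \<or> t j = s2 ! j) \<and>
     misses F t s1 \<le> misses F t s2 + max 1 (card (diffs - F)) \<and>
     misses F t s2 \<le> misses F t s1 + max 1 (card (diffs - F))"

lemma balanced_finite: "balanced F t \<Longrightarrow> finite F"
  by (auto simp: balanced_def intro: finite_subset)

lemma balanced_in_alphabet: "balanced F t \<Longrightarrow> j \<in> F \<Longrightarrow> t j \<in> \<Sigma>"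
  using nth_in_alphabet[of j] by (auto simp: balanced_def subset_iff)

definition opt :: "nat set \<Rightarrow> (nat \<Rightarrow> 'a) \<Rightarrow> real" where
  "opt F t = max ((misses F t s1 + misses F t s2 + card (diffs - F)) / 2)
               (max (misses F t s1) (misses F t s2))"

text \<open>With at least one open differing position, \<open>max 1\<close> disappears from the
  invariant, and the average then dominates both distances.\<close>

lemma opt_eq_half:
  assumes "balanced F t" "diffs - F \<noteq> {}"
  shows "opt F t = (misses F t s1 + misses F t s2 + real (card (diffs - F))) / 2"
proof -
  have "card (diffs - F) > 0"
    using assms(2) finite_diffs by (simp add: card_gt_0_iff)
  with assms(1) have "real (misses F t s1) \<le> misses F t s2 + real (card (diffs - F))"
    "real (misses F t s2) \<le> misses F t s1 + real (card (diffs - F))"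
    by (auto simp: balanced_def max_def split: if_splits)
  then show ?thesis
    by (simp add: opt_def)
qed

text \<open>The left side is the fractional distance to \<open>s\<close>. It is split over the fixed
  positions, the open positions where the two strings differ, and the open positions where they
  agree.\<close>

lemma distance_split:
  fixes x :: "'a \<Rightarrow> nat \<Rightarrow> real"
  assumes F: "F \<subseteq> {..<n}"
    and x: "\<And>j. j \<in> F \<Longrightarrow> x (s ! j) j = of_bool (t j = s ! j)"
  shows "real n - (\<Sum>j<n. x (s ! j) j) = misses F t s +
      (\<Sum>j\<in>diffs - F. 1 - x (s ! j) j) + (\<Sum>j\<in>{..<n} - F - diffs. 1 - x (s ! j) j)"
proof -
  let ?f = "\<lambda>j. 1 - x (s ! j) j"
  have fin: "finite F"
    using F finite_subset by blast
  have "real n - (\<Sum>j<n. x (s ! j) j) = (\<Sum>j<n. ?f j)"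
    by (simp add: sum_subtractf)
  also have "\<dots> = (\<Sum>j\<in>F. ?f j) + (\<Sum>j\<in>{..<n} - F. ?f j)"
    using F by (simp add: sum.subset_diff)
  also have "(\<Sum>j\<in>F. ?f j) = (\<Sum>j\<in>F. of_bool (t j \<noteq> s ! j))"
    using x by (intro sum.cong) auto
  also have "\<dots> = misses F t s"
    using fin by (simp add: misses_def Collect_conj_eq)
  also have "(\<Sum>j\<in>{..<n} - F. ?f j) = (\<Sum>j\<in>diffs - F. ?f j) + (\<Sum>j\<in>{..<n} - F - diffs. ?f j)"
  proof -
    have "({..<n} - F) \<inter> diffs = diffs - F"
      by (auto simp: diffs_def)
    then show ?thesis
      using sum.Int_Diff[of "{..<n} - F" ?f diffs] by simp
  qed
  finally show ?thesis
    by simp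
qed

text \<open>The witness puts weight 1 on common letters and, at each open differing position, weight
  \<open>c\<close> on the letter of \<open>s1\<close> and \<open>1 - c\<close> on that of
  \<open>s2\<close>. For \<open>r > 0\<close>, \<open>c\<close> solves
  \<open>A + r * (1 - c) = B + r * c\<close>, so both distances equal
  \<open>(A + B + r) / 2\<close>; balance is what puts \<open>c\<close> between 0 and 1.\<close>

lemma exists_feasible_opt:
  assumes bal: "balanced F t"
  shows "\<exists>x. lp_feasible \<Sigma> n {s1, s2} (partial_state \<Sigma> F t) x (opt F t)"
proof -
  define A where "A = misses F t s1"
  define B where "B = misses F t s2"
  define r where "r = card (diffs - F)"
  \<comment> \<open>For \<open>r = 0\<close>, division by zero makes \<open>c\<close> equal to \<open>1 / 2\<close>.\<close>
  define c where "c = 1 / 2 + (real A - real B) / (2 * real r)"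
  define x where "x = (\<lambda>a j. if j \<in> F then of_bool (a = t j)
      else if j \<in> diffs then (if a = s1 ! j then c else if a = s2 ! j then 1 - c else 0)
      else of_bool (a = s1 ! j))"
  have F: "F \<subseteq> {..<n}"
    using bal by (simp add: balanced_def)
  \<comment> \<open>The guard is essential: for \<open>r = 0\<close> the invariant still permits a
    gap of one.\<close>
  have AB: "r > 0 \<Longrightarrow> real A \<le> B + real r" "r > 0 \<Longrightarrow> real B \<le> A + real r"
    using bal by (auto simp: balanced_def A_def B_def r_def max_def split: if_splits)
  have c: "0 \<le> c" "c \<le> 1"
    using AB by (cases "r = 0"; simp add: c_def field_simps)+
  have opt: "(A + B + real r) / 2 \<le> opt F t" "A \<le> opt F t" "B \<le> opt F t"
    by (simp_all add: opt_def A_def B_def r_def)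
  have cost: "r * (1 - c) = (r + B - real A) / 2" "r * c = (r + A - real B) / 2" if "r > 0"
    using that by (simp_all add: c_def field_simps)
  have sum1: "(\<Sum>a\<in>\<Sigma>. x a j) = 1" if "j < n" for j
  proof -
    consider "j \<in> F" | "j \<notin> F" "j \<in> diffs" | "j \<notin> F" "j \<notin> diffs"
      by blast
    then show ?thesis
    proof cases
      case 1
      then show ?thesis
        using balanced_in_alphabet[OF bal 1] finite_alphabet by (simp add: x_def of_bool_def)
    next
      case 2
      have "(\<Sum>a\<in>\<Sigma>. x a j) = (\<Sum>a\<in>{s1 ! j, s2 ! j}. x a j)"
        using 2 finite_alphabet nth_in_alphabet[OF that]
        by (intro sum.mono_neutral_right) (auto simp: x_def)
      then show ?thesis
        using 2 by (auto simp: x_def diffs_def)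
    next
      case 3
      then show ?thesis
        using nth_in_alphabet[OF that] finite_alphabet by (simp add: x_def of_bool_def)
    qed
  qed
  have "real n - (\<Sum>j<n. x (s1 ! j) j) = A + (\<Sum>j\<in>diffs - F. 1 - x (s1 ! j) j)
      + (\<Sum>j\<in>{..<n} - F - diffs. 1 - x (s1 ! j) j)"
    unfolding A_def using F by (intro distance_split) (auto simp: x_def)
  also have "\<dots> = A + r * (1 - c)"
    by (simp add: x_def r_def)
  also have "\<dots> \<le> opt F t"
    using opt cost by (cases "r = 0") (auto simp: field_simps)
  finally have d1: "real n - (\<Sum>j<n. x (s1 ! j) j) \<le> opt F t" .
  have "real n - (\<Sum>j<n. x (s2 ! j) j) = B + (\<Sum>j\<in>diffs - F. 1 - x (s2 ! j) j)
      + (\<Sum>j\<in>{..<n} - F - diffs. 1 - x (s2 ! j) j)"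
    unfolding B_def using F by (intro distance_split) (auto simp: x_def)
  also have "(\<Sum>j\<in>diffs - F. 1 - x (s2 ! j) j) = (\<Sum>j\<in>diffs - F. c)"
    by (intro sum.cong) (auto simp: x_def diffs_def)
  also have "(\<Sum>j\<in>{..<n} - F - diffs. 1 - x (s2 ! j) j) = 0"
    by (intro sum.neutral) (auto simp: x_def diffs_def)
  also have "(\<Sum>j\<in>diffs - F. c) = r * c"
    by (simp add: r_def)
  also have "B + r * c + 0 \<le> opt F t"
    using opt cost by (cases "r = 0") (auto simp: field_simps)
  finally have d2: "real n - (\<Sum>j<n. x (s2 ! j) j) \<le> opt F t" .
  have "0 \<le> opt F t"
    by (simp add: opt_def le_max_iff_disj)
  moreover have "0 \<le> x a j \<and> x a j \<le> 1" for a j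
    using c by (simp add: x_def)
  ultimately have "lp_feasible \<Sigma> n {s1, s2} (partial_state \<Sigma> F t) x (opt F t)"
    using sum1 d1 d2 by (auto simp: lp_feasible_def partial_state_def x_def)
  then show ?thesis
    by blast
qed

text \<open>Both estimates end in the same sum, since the letters of \<open>s1\<close> and
  \<open>s2\<close> coincide on the agreeing positions. This lets the two be added.\<close>

lemma feasible_distances:
  fixes x :: "'a \<Rightarrow> nat \<Rightarrow> real"
  assumes bal: "balanced F t"
    and feas: "lp_feasible \<Sigma> n {s1, s2} (partial_state \<Sigma> F t) x d"
  shows "misses F t s1 + (\<Sum>j\<in>diffs - F. 1 - x (s1 ! j) j)
      + (\<Sum>j\<in>{..<n} - F - diffs. 1 - x (s1 ! j) j) \<le> d" (is ?one)
    and "misses F t s2 + (\<Sum>j\<in>diffs - F. 1 - x (s2 ! j) j)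
      + (\<Sum>j\<in>{..<n} - F - diffs. 1 - x (s1 ! j) j) \<le> d" (is ?two)
proof -
  have F: "F \<subseteq> {..<n}"
    using bal by (simp add: balanced_def)
  have fixed: "x a j = of_bool (t j = a)" if "j \<in> F" "a \<in> \<Sigma>" for a j
    using that feas by (auto simp: lp_feasible_def partial_state_def)
  have "real n - (\<Sum>j<n. x (s1 ! j) j) = misses F t s1 +
      (\<Sum>j\<in>diffs - F. 1 - x (s1 ! j) j) + (\<Sum>j\<in>{..<n} - F - diffs. 1 - x (s1 ! j) j)"
    using F nth_in_alphabet by (intro distance_split fixed) auto
  then show ?one
    using feas by (simp add: lp_feasible_def split_beta)
  have "real n - (\<Sum>j<n. x (s2 ! j) j) = misses F t s2 +
      (\<Sum>j\<in>diffs - F. 1 - x (s2 ! j) j) + (\<Sum>j\<in>{..<n} - F - diffs. 1 - x (s2 ! j) j)"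
    using F nth_in_alphabet by (intro distance_split fixed) auto
  also have "(\<Sum>j\<in>{..<n} - F - diffs. 1 - x (s2 ! j) j)
      = (\<Sum>j\<in>{..<n} - F - diffs. 1 - x (s1 ! j) j)"
    by (intro sum.cong) (auto simp: diffs_def)
  finally show ?two
    using feas by (simp add: lp_feasible_def split_beta)
qed

lemma feasible_pair_le:
  assumes "lp_feasible \<Sigma> n {s1, s2} V x d" "j \<in> diffs"
  shows "x (s1 ! j) j + x (s2 ! j) j \<le> 1"
proof -
  have j: "j < n" "s1 ! j \<noteq> s2 ! j"
    using assms(2) by (auto simp: diffs_def)
  have "(\<Sum>a\<in>{s1 ! j, s2 ! j}. x a j) \<le> (\<Sum>a\<in>\<Sigma>. x a j)"
    using finite_alphabet nth_in_alphabet j assms(1)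
    by (intro sum_mono2) (auto simp: lp_feasible_def split_beta)
  also have "\<dots> = 1"
    using assms(1) j by (simp add: lp_feasible_def split_beta)
  finally show ?thesis
    using j by simp
qed

text \<open>Averaging the two distance constraints gives the bound. The weight lost to other letters
  is kept as a nonnegative extra term, so that equality \<open>d = opt F t\<close> later forces it
  to vanish.\<close>

lemma feasible_lower_bound:
  assumes bal: "balanced F t"
    and feas: "lp_feasible \<Sigma> n {s1, s2} (partial_state \<Sigma> F t) x d"
  shows "opt F t + (\<Sum>j\<in>{..<n} - F - diffs. 1 - x (s1 ! j) j) \<le> d" (is ?agree)
    and "diffs - F \<noteq> {} \<Longrightarrow>
      opt F t + (\<Sum>j\<in>diffs - F. 1 - x (s1 ! j) j - x (s2 ! j) j) / 2 \<le> d"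
proof -
  note dist = feasible_distances[OF bal feas]
  let ?g = "\<Sum>j\<in>diffs - F. 1 - x (s1 ! j) j - x (s2 ! j) j"
  let ?e = "\<Sum>j\<in>{..<n} - F - diffs. 1 - x (s1 ! j) j"
  have x1: "x a j \<le> 1" if "a \<in> \<Sigma>" "j < n" for a j
    using feas that by (simp add: lp_feasible_def split_beta)
  have e: "0 \<le> ?e"
    using x1 nth_in_alphabet by (intro sum_nonneg) auto
  have g: "0 \<le> ?g"
    using feasible_pair_le[OF feas] by (intro sum_nonneg) (auto simp: algebra_simps)
  have parts: "0 \<le> (\<Sum>j\<in>diffs - F. 1 - x (s1 ! j) j)" "0 \<le> (\<Sum>j\<in>diffs - F. 1 - x (s2 ! j) j)"
    using x1 nth_in_alphabet by (auto simp: diffs_def intro!: sum_nonneg)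
  have "(\<Sum>j\<in>diffs - F. 1 - x (s1 ! j) j) + (\<Sum>j\<in>diffs - F. 1 - x (s2 ! j) j)
      = card (diffs - F) + ?g"
    by (simp add: sum_subtractf)
  with dist have half:
    "real (misses F t s1) + real (misses F t s2) + real (card (diffs - F)) + ?g + 2 * ?e \<le> 2 * d"
    by linarith
  \<comment> \<open>\<open>opt\<close> is a maximum of three terms: the average comes from
    \<open>half\<close>, the two distances from the single constraints.\<close>
  show ?agree
  proof -
    have "(real (misses F t s1) + real (misses F t s2) + real (card (diffs - F))) / 2 + ?e \<le> d"
      using half g by (simp add: add_divide_distrib)
    moreover have "misses F t s1 + ?e \<le> d"
      using dist(1) parts(1) by linarith
    moreover have "misses F t s2 + ?e \<le> d"
      using dist(2) parts(2) by linarith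
    ultimately show ?thesis
      by (simp add: opt_def max_def)
  qed
  show "opt F t + ?g / 2 \<le> d" if "diffs - F \<noteq> {}"
    using half e opt_eq_half[OF bal that] by (simp add: add_divide_distrib)
qed

lemma opt_le:
  assumes bal: "balanced F t"
    and feas: "lp_feasible \<Sigma> n {s1, s2} (partial_state \<Sigma> F t) x d"
  shows "opt F t \<le> d"
proof -
  have "0 \<le> (\<Sum>j\<in>{..<n} - F - diffs. 1 - x (s1 ! j) j)"
    using feas nth_in_alphabet by (intro sum_nonneg) (auto simp: lp_feasible_def split_beta)
  with feasible_lower_bound(1)[OF bal feas] show ?thesis
    by linarith
qed

lemma exists_optimal:
  assumes "balanced F t"
  shows "\<exists>x. lp_optimal \<Sigma> n {s1, s2} (partial_state \<Sigma> F t) x (opt F t)"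
  using exists_feasible_opt[OF assms] opt_le[OF assms] by (auto simp: lp_optimal_def)

section \<open>Structure of optimal LP solutions\<close>

text \<open>At \<open>d = opt F t\<close> the extra terms of the lower bound are sums of nonnegative
  numbers that are at most 0, so every summand is 0.\<close>

lemma optimal_structure:
  assumes bal: "balanced F t"
    and optimal: "lp_optimal \<Sigma> n {s1, s2} (partial_state \<Sigma> F t) x d"
  shows "d = opt F t"
    and "\<And>j. j < n \<Longrightarrow> j \<notin> F \<Longrightarrow> j \<notin> diffs \<Longrightarrow> x (s1 ! j) j = 1"
    and "\<And>j. j \<in> diffs - F \<Longrightarrow> x (s1 ! j) j + x (s2 ! j) j = 1"
proof -
  have feas: "lp_feasible \<Sigma> n {s1, s2} (partial_state \<Sigma> F t) x d"
    using optimal by (simp add: lp_optimal_def)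
  show d: "d = opt F t"
    using exists_feasible_opt[OF bal] optimal opt_le[OF bal feas]
    by (auto simp: lp_optimal_def intro: antisym)
  show "x (s1 ! j) j = 1" if "j < n" "j \<notin> F" "j \<notin> diffs" for j
  proof -
    have nonneg: "0 \<le> 1 - x (s1 ! j) j" if "j \<in> {..<n} - F - diffs" for j
      using feas that nth_in_alphabet by (auto simp: lp_feasible_def split_beta)
    then have "(\<Sum>j\<in>{..<n} - F - diffs. 1 - x (s1 ! j) j) = 0"
      using feasible_lower_bound(1)[OF bal feas] d by (intro antisym sum_nonneg) auto
    with nonneg have "\<forall>j\<in>{..<n} - F - diffs. 1 - x (s1 ! j) j = 0"
      by (subst (asm) sum_nonneg_eq_0_iff) auto
    with that show ?thesis
      by simp
  qed
  show "x (s1 ! j) j + x (s2 ! j) j = 1" if j: "j \<in> diffs - F" for j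
  proof -
    have nonneg: "0 \<le> 1 - x (s1 ! j) j - x (s2 ! j) j" if "j \<in> diffs - F" for j
      using feasible_pair_le[OF feas, of j] that by auto
    moreover have "diffs - F \<noteq> {}"
      using j by blast
    ultimately have "(\<Sum>j\<in>diffs - F. 1 - x (s1 ! j) j - x (s2 ! j) j) = 0"
      using feasible_lower_bound(2)[OF bal feas] d by (intro antisym sum_nonneg) auto
    with nonneg have "\<forall>j\<in>diffs - F. 1 - x (s1 ! j) j - x (s2 ! j) j = 0"
      using finite_diffs by (subst (asm) sum_nonneg_eq_0_iff) auto
    with j show ?thesis
      by force
  qed
qed

text \<open>The letters of \<open>s1\<close> and \<open>s2\<close> already use up the whole weight 1
  at an open position, leaving nothing for a third letter.\<close>

lemma positive_optimal_letter:
  assumes bal: "balanced F t"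
    and optimal: "lp_optimal \<Sigma> n {s1, s2} (partial_state \<Sigma> F t) x d"
    and b: "b \<in> \<Sigma>" "k < n" "k \<notin> F" "0 < x b k"
  shows "b = s1 ! k \<or> b = s2 ! k"
proof (rule ccontr)
  assume other: "\<not> ?thesis"
  have feas: "lp_feasible \<Sigma> n {s1, s2} (partial_state \<Sigma> F t) x d"
    using optimal by (simp add: lp_optimal_def)
  let ?T = "{s1 ! k, s2 ! k}"
  have T: "(\<Sum>a\<in>?T. x a k) = 1"
    using optimal_structure(2,3)[OF bal optimal, of k] b
    by (cases "k \<in> diffs") (auto simp: diffs_def)
  have "(\<Sum>a\<in>insert b ?T. x a k) \<le> (\<Sum>a\<in>\<Sigma>. x a k)"
    using finite_alphabet nth_in_alphabet[OF b(2)] b feas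
    by (intro sum_mono2) (auto simp: lp_feasible_def split_beta)
  also have "\<dots> = 1"
    using feas b(2) by (simp add: lp_feasible_def split_beta)
  finally show False
    using other T b(4) by simp
qed

section \<open>Rounds of the algorithm\<close>

lemma balanced_step:
  assumes bal: "balanced F t" and card: "card F < n"
    and step: "stepA \<Sigma> n {s1, s2} (partial_state \<Sigma> F t) V'"
  shows "\<exists>F' t'. V' = partial_state \<Sigma> F' t' \<and> balanced F' t' \<and> card F' = Suc (card F)"
proof -
  obtain V1 V0 where V: "partial_state \<Sigma> F t = (V1, V0)"
    by fastforce
  then have mem: "(a, j) \<in> V1 \<longleftrightarrow> j \<in> F \<and> a = t j" "(a, j) \<in> V0 \<longleftrightarrow> j \<in> F \<and> a \<in> \<Sigma> \<and> a \<noteq> t j"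
    for a j
    by (auto simp: partial_state_def)
  from step V obtain x d b k where
    optimal: "lp_optimal \<Sigma> n {s1, s2} (partial_state \<Sigma> F t) x d"
    and b: "b \<in> \<Sigma>" "k < n" "(b, k) \<notin> V1"
    and largest: "\<And>a j. a \<in> \<Sigma> \<Longrightarrow> j < n \<Longrightarrow> (a, j) \<notin> V1 \<Longrightarrow> x a j \<le> x b k"
    and V': "V' = (insert (b, k) V1, V0 \<union> {(a, k) |a. a \<in> \<Sigma> \<and> a \<noteq> b})"
    by (auto simp: stepA_def)
  have feas: "lp_feasible \<Sigma> n {s1, s2} (partial_state \<Sigma> F t) x d"
    using optimal by (simp add: lp_optimal_def)
  note fin = balanced_finite[OF bal]
  have F: "F \<subseteq> {..<n}"
    using bal by (simp add: balanced_def)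
  \<comment> \<open>The selection rule excludes only \<open>V1\<close>, so a variable fixed to 0
    could be a candidate. An open position has total weight 1, hence a positive candidate, and the
    largest value is positive too.\<close>
  have pos: "0 < x b k"
  proof -
    have "F \<noteq> {..<n}"
      using card by auto
    with F obtain j where j: "j < n" "j \<notin> F"
      by blast
    have "(\<Sum>a\<in>\<Sigma>. x a j) = 1"
      using feas j by (simp add: lp_feasible_def split_beta)
    then have "\<not> (\<forall>a\<in>\<Sigma>. x a j \<le> 0)"
      using sum_nonpos[of \<Sigma> "\<lambda>a. x a j"] by auto
    then obtain a where "a \<in> \<Sigma>" "0 < x a j"
      by force
    with largest[of a j] j mem show ?thesis
      by force
  qed
  have k: "k \<notin> F"
  proof
    assume "k \<in> F"
    with b mem have "(b, k) \<in> V0"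
      by auto
    with feas V have "x b k = 0"
      by (auto simp: lp_feasible_def)
    with pos show False
      by simp
  qed
  have letter: "b = s1 ! k \<or> b = s2 ! k"
    using positive_optimal_letter[OF bal optimal b(1,2) k pos] .
  let ?F = "insert k F" and ?t = "t(k := b)"
  have "V' = partial_state \<Sigma> ?F ?t"
    unfolding V' partial_state_insert[OF k] V by simp
  moreover have "card ?F = Suc (card F)"
    using fin k by simp
  moreover have "balanced ?F ?t"
  proof -
    let ?R = "diffs - F"
    have lt: "j < n" if "j \<in> ?R" for j
      using that by (auto simp: diffs_def)
    have miss: "misses ?F ?t s = misses F t s + of_bool (b \<noteq> s ! k)" for s
      using misses_insert[OF fin k] .
    have balance: "misses ?F ?t s1 \<le> misses ?F ?t s2 + max 1 (card (diffs - ?F)) \<and>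
        misses ?F ?t s2 \<le> misses ?F ?t s1 + max 1 (card (diffs - ?F))"
    proof (cases "k \<in> diffs")
      \<comment> \<open>Both distances change by the same amount and no differing position is used
        up.\<close>
      case False
      then have "s1 ! k = s2 ! k" "diffs - ?F = diffs - F"
        using b(2) by (auto simp: diffs_def)
      with bal show ?thesis
        by (simp add: miss balanced_def)
    next
      case True
      with k have kR: "k \<in> ?R"
        by simp
      have ne: "s1 ! k \<noteq> s2 ! k"
        using True by (simp add: diffs_def)
      have "diffs - ?F = ?R - {k}"
        by auto
      then have card': "card (diffs - ?F) = card ?R - 1"
        using kR finite_diffs by simp
      note pair = optimal_structure(3)[OF bal optimal]
      \<comment> \<open>Because the weights pair to 1, what one string lacks is the weight of the
        other; this brings the constraints into the form of \<open>total\<close> in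
        \<open>largest_choice_balanced\<close>.\<close>
      have sums: "(\<Sum>j\<in>?R. 1 - x (s1 ! j) j) = (\<Sum>j\<in>?R. x (s2 ! j) j)"
        "(\<Sum>j\<in>?R. 1 - x (s2 ! j) j) = (\<Sum>j\<in>?R. x (s1 ! j) j)"
        using pair by (auto intro!: sum.cong simp: algebra_simps)
      have "(\<Sum>j\<in>{..<n} - F - diffs. 1 - x (s1 ! j) j) = 0"
        using optimal_structure(2)[OF bal optimal] by (intro sum.neutral) auto
      moreover have "d = (misses F t s1 + misses F t s2 + real (card ?R)) / 2"
        using optimal_structure(1)[OF bal optimal] opt_eq_half[OF bal] kR by force
      ultimately have total:
        "misses F t s1 + (\<Sum>j\<in>?R. x (s2 ! j) j)
          \<le> (misses F t s1 + misses F t s2 + real (card ?R)) / 2"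
        "misses F t s2 + (\<Sum>j\<in>?R. x (s1 ! j) j)
          \<le> (misses F t s2 + misses F t s1 + real (card ?R)) / 2"
        using feasible_distances[OF bal feas] sums by (simp_all add: add.commute)
      have nonneg: "0 \<le> x (s1 ! j) j" "0 \<le> x (s2 ! j) j" if "j \<in> ?R" for j
        using feas lt[OF that] nth_in_alphabet by (auto simp: lp_feasible_def split_beta)
      have largest': "x (s1 ! j) j \<le> x b k" "x (s2 ! j) j \<le> x b k" if "j \<in> ?R" for j
        using largest lt[OF that] nth_in_alphabet mem that by auto
      \<comment> \<open>This settles the direction in which the pick narrows the gap: the allowance
        \<open>max 1 (card ?R)\<close> drops by at most one, while the smaller-side distance gains
        one.\<close>
      have old: "misses F t s1 \<le> misses F t s2 + max 1 (card ?R)"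
        "misses F t s2 \<le> misses F t s1 + max 1 (card ?R)"
        using bal by (auto simp: balanced_def)
      from letter show ?thesis
      proof
        assume s: "b = s1 ! k"
        have "Suc (misses F t s2) \<le> misses F t s1 + max 1 (card ?R - 1)"
          using finite_diffs kR
        proof (intro largest_choice_balanced[where p = "\<lambda>j. x (s2 ! j) j" and q = "\<lambda>j. x (s1 ! j) j"])
          show "x (s2 ! j) j + x (s1 ! j) j = 1" if "j \<in> ?R" for j
            using pair[OF that] by simp
        qed (use nonneg largest' total s in auto)
        then show ?thesis
          unfolding miss card' using old ne by (auto simp: s max_def split: if_splits)
      next
        assume s: "b = s2 ! k"
        have "Suc (misses F t s1) \<le> misses F t s2 + max 1 (card ?R - 1)"
          using finite_diffs kR
          by (intro largest_choice_balanced[where p = "\<lambda>j. x (s1 ! j) j" and q = "\<lambda>j. x (s2 ! j) j"])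
            (use nonneg largest' total s pair in auto)
        then show ?thesis
          unfolding miss card' using old ne by (auto simp: s max_def split: if_splits)
      qed
    qed
    show ?thesis
      using bal balance b(2) letter by (simp add: balanced_def)
  qed
  ultimately show ?thesis
    by blast
qed

lemma step_exists:
  assumes bal: "balanced F t" and card: "card F < n"
  shows "\<exists>V'. stepA \<Sigma> n {s1, s2} (partial_state \<Sigma> F t) V'"
proof -
  obtain V1 V0 where V: "partial_state \<Sigma> F t = (V1, V0)"
    by fastforce
  obtain x where x: "lp_optimal \<Sigma> n {s1, s2} (V1, V0) x (opt F t)"
    using exists_optimal[OF bal] V by auto
  define X where "X = {(a, j). a \<in> \<Sigma> \<and> j < n \<and> (a, j) \<notin> V1}"
  have "X \<subseteq> \<Sigma> \<times> {..<n}"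
    by (auto simp: X_def)
  then have finX: "finite X"
    using finite_alphabet finite_subset by blast
  have "F \<subseteq> {..<n}" "F \<noteq> {..<n}"
    using bal card by (auto simp: balanced_def)
  then obtain j where "j < n" "j \<notin> F"
    by blast
  \<comment> \<open>An open position supplies a candidate, so the maximum over the finite set
    \<open>X\<close> exists.\<close>
  then have "(s1 ! j, j) \<in> X"
    using V nth_in_alphabet by (auto simp: X_def partial_state_def)
  with finX have "Max ((\<lambda>(a, j). x a j) ` X) \<in> (\<lambda>(a, j). x a j) ` X"
    by (intro Max_in) auto
  then obtain b k where bk: "(b, k) \<in> X" "Max ((\<lambda>(a, j). x a j) ` X) = x b k"
    by auto
  have "x a j \<le> x b k" if "(a, j) \<in> X" for a j
    unfolding bk(2)[symmetric] using finX that by (intro Max_ge) (force intro: rev_image_eqI)+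
  with x bk(1) have "stepA \<Sigma> n {s1, s2} (V1, V0)
      (insert (b, k) V1, V0 \<union> {(a, k) |a. a \<in> \<Sigma> \<and> a \<noteq> b})"
    unfolding stepA_def X_def by blast
  with V show ?thesis
    by auto
qed

lemma reachable_balanced:
  assumes "i \<le> n" "(stepA \<Sigma> n {s1, s2} ^^ i) ({}, {}) V"
  shows "\<exists>F t. V = partial_state \<Sigma> F t \<and> balanced F t \<and> card F = i"
  using assms
proof (induction i arbitrary: V)
  case 0
  \<comment> \<open>No position is fixed yet, so any letter function will do.\<close>
  have "balanced {} (\<lambda>_. undefined)"
    by (simp add: balanced_def misses_def)
  with 0 show ?case
    using partial_state_empty[of \<Sigma> "\<lambda>_. undefined"]
    by (metis card.empty relpowp_0_E)
next
  case (Suc i)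
  from Suc.prems(2) obtain W where
    "(stepA \<Sigma> n {s1, s2} ^^ i) ({}, {}) W" "stepA \<Sigma> n {s1, s2} W V"
    by auto
  with Suc show ?case
    using balanced_step by (metis Suc_le_lessD less_imp_le)
qed

lemma final_balanced:
  assumes "(stepA \<Sigma> n {s1, s2} ^^ n) ({}, {}) V"
  shows "\<exists>t. V = partial_state \<Sigma> {..<n} t \<and> balanced {..<n} t"
proof -
  obtain F t where V: "V = partial_state \<Sigma> F t" and bal: "balanced F t" and "card F = n"
    using reachable_balanced[OF order.refl assms] by blast
  then have "F = {..<n}"
    by (intro card_subset_eq) (auto simp: balanced_def)
  with V bal show ?thesis
    by blast
qed

section \<open>Optimality of the final string\<close>

text \<open>The triangle inequality: where \<open>s1\<close> and \<open>s2\<close> differ,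
  \<open>u\<close> disagrees with at least one of them.\<close>

lemma card_diffs_le:
  assumes "length u = n"
  shows "card diffs \<le> hamming u s1 + hamming u s2"
proof -
  have "card diffs \<le> card ({j. j < length u \<and> u ! j \<noteq> s1 ! j} \<union> {j. j < length u \<and> u ! j \<noteq> s2 ! j})"
    using assms by (intro card_mono) (auto simp: diffs_def)
  also have "\<dots> \<le> hamming u s1 + hamming u s2"
    unfolding hamming_def by (rule card_Un_le)
  finally show ?thesis .
qed

lemma balanced_string_optimal:
  assumes bal: "balanced {..<n} t"
  defines "u \<equiv> map t [0..<n]"
  shows "u \<in> strings \<Sigma> n"
    and "max (hamming u s1) (hamming u s2)
      = Min ((\<lambda>u. max (hamming u s1) (hamming u s2)) ` strings \<Sigma> n)"
proof -
  show u: "u \<in> strings \<Sigma> n"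
    using balanced_in_alphabet[OF bal] by (auto simp: u_def strings_def)
  have miss: "hamming u s = misses {..<n} t s" for s
    unfolding hamming_def misses_def by (rule arg_cong[where f = card]) (auto simp: u_def)
  have none: "diffs - {..<n} = {}"
    by (auto simp: diffs_def)
  then have near: "hamming u s1 \<le> hamming u s2 + 1" "hamming u s2 \<le> hamming u s1 + 1"
    using bal unfolding balanced_def none by (simp_all add: miss)
  \<comment> \<open>At each position \<open>t\<close> agrees with one of the two strings, so the two
    sets of misses are disjoint and together form \<open>diffs\<close>.\<close>
  have "misses {..<n} t s1 + misses {..<n} t s2
      = card ({j\<in>{..<n}. t j \<noteq> s1 ! j} \<union> {j\<in>{..<n}. t j \<noteq> s2 ! j})"
    unfolding misses_def using bal by (subst card_Un_disjoint) (auto simp: balanced_def)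
  also have "{j\<in>{..<n}. t j \<noteq> s1 ! j} \<union> {j\<in>{..<n}. t j \<noteq> s2 ! j} = diffs"
  proof (rule set_eqI)
    fix j
    have "j < n \<Longrightarrow> t j = s1 ! j \<or> t j = s2 ! j"
      using bal by (simp add: balanced_def)
    then show "j \<in> {j\<in>{..<n}. t j \<noteq> s1 ! j} \<union> {j\<in>{..<n}. t j \<noteq> s2 ! j} \<longleftrightarrow> j \<in> diffs"
      by (auto simp: diffs_def)
  qed
  finally have total: "hamming u s1 + hamming u s2 = card diffs"
    by (simp add: miss)
  show "max (hamming u s1) (hamming u s2)
      = Min ((\<lambda>u. max (hamming u s1) (hamming u s2)) ` strings \<Sigma> n)"
  proof (rule Min_eqI[symmetric])
    show "finite ((\<lambda>u. max (hamming u s1) (hamming u s2)) ` strings \<Sigma> n)"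
      using finite_lists_length_eq[OF finite_alphabet, of n]
      by (simp add: strings_def conj_commute)
    show "max (hamming u s1) (hamming u s2) \<le> y"
      if "y \<in> (\<lambda>u. max (hamming u s1) (hamming u s2)) ` strings \<Sigma> n" for y
    proof -
      from that obtain v where v: "length v = n" "y = max (hamming v s1) (hamming v s2)"
        by (auto simp: strings_def)
      \<comment> \<open>Twice the larger distance of \<open>u\<close> is at most
        \<open>card diffs + 1\<close>, and \<open>card diffs\<close> is at most
        \<open>2 * y\<close>; integrality closes the gap.\<close>
      with card_diffs_le[OF v(1)] near total show ?thesis
        by linarith
    qed
  qed (use u in blast)
qed

end

text \<open>The first two conjuncts keep the third from being vacuous: no run gets stuck before
  round \<open>n\<close>, and each complete run yields exactly one string.\<close>

theorem theorem1:
  fixes \<Sigma> :: "'a set" and n :: nat and s1 s2 :: "'a list"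
  assumes "finite \<Sigma>" and "s1 \<in> strings \<Sigma> n" and "s2 \<in> strings \<Sigma> n"
  shows "(\<forall>i<n. \<forall>V. (stepA \<Sigma> n {s1, s2} ^^ i) ({}, {}) V \<longrightarrow> (\<exists>V'. stepA \<Sigma> n {s1, s2} V V')) \<and>
    (\<forall>V. (stepA \<Sigma> n {s1, s2} ^^ n) ({}, {}) V \<longrightarrow> (\<exists>!t. reads_off n V t)) \<and>
    (\<forall>t. outputsA \<Sigma> n {s1, s2} t \<longrightarrow>
      t \<in> strings \<Sigma> n \<and>
      max (hamming t s1) (hamming t s2) =
        Min ((\<lambda>u. max (hamming u s1) (hamming u s2)) ` strings \<Sigma> n))"
proof -
  interpret two_strings \<Sigma> n s1 s2
    using assms by unfold_locales
  have "\<exists>V'. stepA \<Sigma> n {s1, s2} V V'"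
    if "i < n" "(stepA \<Sigma> n {s1, s2} ^^ i) ({}, {}) V" for i V
    using reachable_balanced[OF less_imp_le that(2)] that(1) step_exists by blast
  moreover have "\<exists>!t. reads_off n V t" if "(stepA \<Sigma> n {s1, s2} ^^ n) ({}, {}) V" for V
    using final_balanced[OF that] reads_off_partial_state by metis
  moreover have "t \<in> strings \<Sigma> n \<and> max (hamming t s1) (hamming t s2)
      = Min ((\<lambda>u. max (hamming u s1) (hamming u s2)) ` strings \<Sigma> n)"
    if "outputsA \<Sigma> n {s1, s2} t" for t
  proof -
    from that obtain V where V: "(stepA \<Sigma> n {s1, s2} ^^ n) ({}, {}) V" "reads_off n V t"
      by (auto simp: outputsA_def)
    then obtain f where "balanced {..<n} f" "t = map f [0..<n]"
      using final_balanced reads_off_partial_state by metis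
    then show ?thesis
      using balanced_string_optimal by simp
  qed
  ultimately show ?thesis
    by blast
qed

end
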